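(* Let $n\ge 2$ be an integer and let $r>0$ be real. Let $X, X_1,X_2,\ldots$ be i.i.d. real random variables with distribution $F$, let $T_n$ be the $t$-statistic of $X_1,\ldots,X_n$, and write $p_x=\mathrm{P}(X=x)$. Then the following three quantities (each with values in $[0,\infty]$) are either all finite or all infinite: (i) $\mathrm{E}|T_n|^r$; (ii) $\mathrm{E}\Bigl(|X_1|^r\,\bigl(\min_{2\le i\le n}|X_i-X_1|^{-r}\bigr)\, I\{|X_i-X_1|>0 \text{ for some } i\le n\}\Bigr)$; (iii) $\displaystyle\int_{x\neq 0}\int_0^1 h^{-(r+1)}\Bigl(\bigl(\mathrm{P}(|X-x|<h|x|)\bigr)^{n-1}-p_x^{n-1}\Bigr)\,\mathrm{d}h\,\mathrm{d}F(x)$.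
   Context: For $n\ge2$ set $S_n=\sum_{i=1}^n X_i$ and $\hat\sigma_n^2=\frac{1}{n-1}\sum_{i=1}^n (X_i-n^{-1}S_n)^2$, with $\hat\sigma_n\ge 0$. The $t$-statistic is $T_n=n^{-1/2}\hat\sigma_n^{-1}S_n$ if $\hat\sigma_n>0$ and $T_n=0$ if $\hat\sigma_n=0$. $I\{\cdot\}$ denotes the indicator of an event. In (ii), $|X_i-X_1|^{-r}=+\infty$ when $X_i=X_1$, and the whole expression inside the expectation is $0$ when the indicator is $0$. *)

theory Defs
  imports "HOL-Probability.Probability"
begin

text \<open>The sample is \<open>x 1, \<dots>, x n\<close>; the value \<open>x 0\<close> is not part of it.\<close>

definition partial_sum :: "nat \<Rightarrow> (nat \<Rightarrow> real) \<Rightarrow> real" where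
  "partial_sum n x = (\<Sum>i=1..n. x i)"

definition sigma_hat :: "nat \<Rightarrow> (nat \<Rightarrow> real) \<Rightarrow> real" where
  "sigma_hat n x =
     sqrt (1 / (real n - 1) * (\<Sum>i=1..n. (x i - partial_sum n x / real n)\<^sup>2))"

definition t_statistic :: "nat \<Rightarrow> (nat \<Rightarrow> real) \<Rightarrow> real" where
  "t_statistic n x =
     (if sigma_hat n x > 0
      then real n powr (- 1 / 2) * inverse (sigma_hat n x) * partial_sum n x
      else 0)"

text \<open>\<open>\<bar>d\<bar>\<close> to the power \<open>- r\<close> with value \<open>\<infinity>\<close> at \<open>d = 0\<close>, where \<open>0 powr (- r)\<close> would be \<open>0\<close>.\<close>

definition abs_neg_power :: "real \<Rightarrow> real \<Rightarrow> ennreal" where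
  "abs_neg_power r d = (if d = 0 then \<infinity> else ennreal (\<bar>d\<bar> powr (- r)))"

end

theory Submission
  imports Defs
begin

text \<open>
  Let \<open>D\<close> be the largest of \<open>\<bar>X i - X 1\<bar>\<close> and \<open>R = \<bar>X 1\<bar> / D\<close>. Quantity (ii) is
  \<open>E (R powr r)\<close>. Up to constants \<open>D\<close> is the sample deviation, and the sample mean differs from
  \<open>X 1\<close> by at most \<open>D\<close>, so \<open>\<bar>T\<bar>\<close> and \<open>R\<close> bound each other linearly, which settles (i).
  Given \<open>X 1 = x\<close>, the bracket in (iii) is the probability of \<open>0 < D < h \<bar>x\<bar>\<close>; integrating
  in \<open>h\<close> first turns (iii) into the expectation of the positive part of \<open>(R powr r - 1) / r\<close>.

  Since \<open>t / 0 = 0\<close> and \<open>0 powr r = 0\<close>, no separate treatment of \<open>D = 0\<close> is needed in \<open>R\<close>.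
\<close>

section \<open>Maximal deviation from a centre\<close>

text \<open>The centre \<open>c\<close> is an argument of its own so that it can be held at a fixed
  value of the first observation while the others stay random. Index 1 is left out: with
  \<open>c = x 1\<close> it would only contribute 0.\<close>

definition max_dev :: "nat \<Rightarrow> real \<Rightarrow> (nat \<Rightarrow> real) \<Rightarrow> real" where
  "max_dev n c x = Max ((\<lambda>i. \<bar>x i - c\<bar>) ` {2..n})"

lemma max_dev_less_iff:
  assumes "n \<ge> 2"
  shows "max_dev n c x < a \<longleftrightarrow> (\<forall>i\<in>{2..n}. \<bar>x i - c\<bar> < a)"
  unfolding max_dev_def using assms by (subst Max_less_iff) auto

lemma max_dev_upper: "i \<in> {2..n} \<Longrightarrow> \<bar>x i - c\<bar> \<le> max_dev n c x"
  unfolding max_dev_def by (rule Max_ge) auto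

lemma max_dev_attained:
  assumes "n \<ge> 2"
  obtains i where "i \<in> {2..n}" "max_dev n c x = \<bar>x i - c\<bar>"
proof -
  have "max_dev n c x \<in> (\<lambda>i. \<bar>x i - c\<bar>) ` {2..n}"
    unfolding max_dev_def using assms by (intro Max_in) auto
  then show ?thesis using that by auto
qed

lemma max_dev_nonneg: "n \<ge> 2 \<Longrightarrow> 0 \<le> max_dev n c x"
  using max_dev_upper[of 2 n x c] by fastforce

lemma max_dev_pos_iff:
  assumes "n \<ge> 2"
  shows "0 < max_dev n c x \<longleftrightarrow> (\<exists>i\<in>{2..n}. x i \<noteq> c)"
proof
  assume "0 < max_dev n c x"
  then show "\<exists>i\<in>{2..n}. x i \<noteq> c"
    using max_dev_attained[OF assms, of c x] by force
next
  assume "\<exists>i\<in>{2..n}. x i \<noteq> c"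
  then obtain i where "i \<in> {2..n}" "x i \<noteq> c" by blast
  then show "0 < max_dev n c x"
    using max_dev_upper[of i n x c] by (smt (verit))
qed

text \<open>Exhibits the deviation as a function on the product space over \<open>{2..n}\<close>,
  where independence from the first observation can be applied.\<close>

lemma max_dev_restrict: "max_dev n c (restrict x {2..n}) = max_dev n c x"
  unfolding max_dev_def by (intro arg_cong[where f=Max] image_cong) auto

lemma max_dev_first: "i \<in> {1..n} \<Longrightarrow> n \<ge> 2 \<Longrightarrow> \<bar>x i - x 1\<bar> \<le> max_dev n (x 1) x"
  by (cases "i = 1") (auto intro: max_dev_upper max_dev_nonneg)

section \<open>Linear comparison of the t-statistic with the ratio |x 1| / D\<close>

lemma abs_partial_sum_diff_le:
  assumes "n \<ge> 2"
  shows "\<bar>partial_sum n x - n * x 1\<bar> \<le> n * max_dev n (x 1) x"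
proof -
  have "partial_sum n x - n * x 1 = (\<Sum>i=1..n. x i - x 1)"
    by (simp add: partial_sum_def sum_subtractf)
  also have "\<bar>\<dots>\<bar> \<le> (\<Sum>i=1..n. max_dev n (x 1) x)"
    using max_dev_first assms by (intro order.trans[OF sum_abs] sum_mono) auto
  finally show ?thesis by simp
qed

text \<open>Steiner's identity: expanding around the mean, the cross terms cancel because the
  deviations from the mean sum to 0.\<close>

lemma sum_squares_dev:
  fixes x :: "nat \<Rightarrow> real"
  assumes "n \<ge> 1"
  shows "(\<Sum>i=1..n. (x i - c)\<^sup>2)
    = (\<Sum>i=1..n. (x i - partial_sum n x / n)\<^sup>2) + n * (partial_sum n x / n - c)\<^sup>2"
proof -
  define m where "m = partial_sum n x / n"
  have m: "(\<Sum>i=1..n. x i) = n * m"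
    using assms by (simp add: m_def partial_sum_def)
  have "(\<Sum>i=1..n. (x i - c)\<^sup>2)
      = (\<Sum>i=1..n. (x i - m)\<^sup>2 + (m - c)\<^sup>2 + 2 * (m - c) * (x i - m))"
    by (intro sum.cong) (auto simp: power2_eq_square algebra_simps)
  also have "\<dots> = (\<Sum>i=1..n. (x i - m)\<^sup>2) + n * (m - c)\<^sup>2 + 2 * (m - c) * ((\<Sum>i=1..n. x i) - n * m)"
    by (simp add: sum.distrib sum_distrib_left[symmetric] sum_subtractf)
  finally show ?thesis using m by (simp add: m_def)
qed

text \<open>By Steiner's identity the mean minimises the sum of squares, so centring at
  \<open>x 1\<close> can only enlarge it. The first term is then 0, and the remaining
  \<open>n - 1\<close> terms cancel the normalisation.\<close>

lemma sigma_hat_le_max_dev: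
  assumes "n \<ge> 2"
  shows "sigma_hat n x \<le> max_dev n (x 1) x"
proof -
  let ?D = "max_dev n (x 1) x"
  have "(\<Sum>i=1..n. (x i - partial_sum n x / n)\<^sup>2) \<le> (\<Sum>i=1..n. (x i - x 1)\<^sup>2)"
    using assms by (subst (2) sum_squares_dev) auto
  also have "\<dots> = (\<Sum>i=2..n. (x i - x 1)\<^sup>2)"
    using assms by (subst sum.atLeast_Suc_atMost) (auto simp: numeral_2_eq_2)
  also have "\<dots> \<le> (\<Sum>i=2..n. ?D\<^sup>2)"
    using max_dev_upper[of _ n x "x 1"]
    by (intro sum_mono) (metis abs_ge_zero power2_abs power_mono)
  also have "\<dots> = (real n - 1) * ?D\<^sup>2"
    using assms by (simp add: of_nat_diff)
  finally have "1 / (real n - 1) * (\<Sum>i=1..n. (x i - partial_sum n x / n)\<^sup>2) \<le> ?D\<^sup>2"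
    using assms by (simp add: field_simps)
  then show ?thesis
    unfolding sigma_hat_def using max_dev_nonneg[OF assms] by (intro real_le_lsqrt) auto
qed

text \<open>The first observation and the one farthest from it alone contribute at least half of the
  squared maximal deviation to the sum of squares; hence the factor 2 under the root.\<close>

lemma max_dev_le_sigma_hat:
  assumes "n \<ge> 2"
  shows "max_dev n (x 1) x \<le> sqrt (2 * (real n - 1)) * sigma_hat n x"
proof -
  define m where "m = partial_sum n x / n"
  obtain k where k: "k \<in> {2..n}" "max_dev n (x 1) x = \<bar>x k - x 1\<bar>"
    using max_dev_attained[OF assms] .
  \<comment> \<open>Parallelogram law for \<open>x k - m\<close> and \<open>x 1 - m\<close>.\<close>
  have "2 * ((x k - m)\<^sup>2 + (x 1 - m)\<^sup>2) - (x k - x 1)\<^sup>2 = (x k + x 1 - 2 * m)\<^sup>2"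
    by (simp add: power2_eq_square algebra_simps)
  then have "(x k - x 1)\<^sup>2 \<le> 2 * ((x k - m)\<^sup>2 + (x 1 - m)\<^sup>2)"
    by (smt (verit) zero_le_power2)
  also have "(x k - m)\<^sup>2 + (x 1 - m)\<^sup>2 = (\<Sum>i\<in>{k, 1}. (x i - m)\<^sup>2)"
    using k by simp
  also have "\<dots> \<le> (\<Sum>i=1..n. (x i - m)\<^sup>2)"
    using k by (intro sum_mono2) auto
  finally have "(x k - x 1)\<^sup>2 \<le> 2 * (\<Sum>i=1..n. (x i - m)\<^sup>2)"
    by simp
  then have "sqrt ((x k - x 1)\<^sup>2) \<le> sqrt (2 * (\<Sum>i=1..n. (x i - m)\<^sup>2))"
    by (rule real_sqrt_le_mono)
  also have "2 * (\<Sum>i=1..n. (x i - m)\<^sup>2)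
      = 2 * (real n - 1) * (1 / (real n - 1) * (\<Sum>i=1..n. (x i - m)\<^sup>2))"
    using assms by (simp add: field_simps)
  also have "sqrt \<dots> = sqrt (2 * (real n - 1)) * sigma_hat n x"
    unfolding sigma_hat_def m_def by (rule real_sqrt_mult)
  finally show ?thesis
    using k by simp
qed

text \<open>The two preceding bounds show that the default value of the t-statistic applies exactly
  when the ratio has denominator 0.\<close>

lemma sigma_hat_pos_iff:
  assumes "n \<ge> 2"
  shows "0 < sigma_hat n x \<longleftrightarrow> 0 < max_dev n (x 1) x"
proof
  assume "0 < max_dev n (x 1) x"
  then have "0 < sqrt (2 * (real n - 1)) * sigma_hat n x"
    using max_dev_le_sigma_hat[OF assms, of x] by linarith
  then show "0 < sigma_hat n x"
    using assms by (simp add: zero_less_mult_iff)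
qed (use sigma_hat_le_max_dev[OF assms, of x] in linarith)

lemma abs_t_statistic_eq:
  assumes "0 < sigma_hat n x"
  shows "\<bar>t_statistic n x\<bar> = \<bar>partial_sum n x\<bar> / (sqrt n * sigma_hat n x)"
  using assms
  by (simp add: t_statistic_def abs_mult powr_minus powr_half_sqrt field_simps)

text \<open>The sum is at most n (|x 1| + D) in absolute value, and the sample deviation is at least
  D / sqrt (2 (n - 1)). Dividing turns D into the summand 1, and n / sqrt n = sqrt n joins the
  root.\<close>

lemma abs_t_statistic_le:
  assumes "n \<ge> 2"
  shows "\<bar>t_statistic n x\<bar>
    \<le> sqrt (2 * real n * (real n - 1)) * (\<bar>x 1\<bar> / max_dev n (x 1) x + 1)"
proof (cases "0 < sigma_hat n x")
  case True
  let ?D = "max_dev n (x 1) x"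
  have D: "0 < ?D" using True sigma_hat_pos_iff[OF assms] by blast
  have "\<bar>partial_sum n x\<bar> \<le> \<bar>n * x 1\<bar> + \<bar>partial_sum n x - n * x 1\<bar>"
    by linarith
  also have "\<dots> \<le> n * (\<bar>x 1\<bar> + ?D)"
    using abs_partial_sum_diff_le[OF assms, of x] by (simp add: abs_mult algebra_simps)
  finally have S: "\<bar>partial_sum n x\<bar> \<le> n * (\<bar>x 1\<bar> + ?D)" .
  have "\<bar>t_statistic n x\<bar> = \<bar>partial_sum n x\<bar> / (sqrt n * sigma_hat n x)"
    by (rule abs_t_statistic_eq[OF True])
  also have "\<dots> \<le> n * (\<bar>x 1\<bar> + ?D) / (sqrt n * (?D / sqrt (2 * (real n - 1))))"
    using S D assms max_dev_le_sigma_hat[OF assms, of x]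
    by (intro frac_le mult_left_mono) (auto simp: field_simps)
  also have "\<dots> = (n / sqrt n) * sqrt (2 * (real n - 1)) * (\<bar>x 1\<bar> / ?D + 1)"
    using D assms by (simp add: field_simps)
  also have "(n / sqrt n) * sqrt (2 * (real n - 1)) = sqrt (2 * real n * (real n - 1))"
    by (simp add: real_div_sqrt real_sqrt_mult[symmetric] ac_simps)
  finally show ?thesis .
next
  case False
  then show ?thesis
    using assms max_dev_nonneg[OF assms] by (auto simp: t_statistic_def)
qed

text \<open>|x 1| is at most the absolute mean plus D. Dividing by D gives the summand 1; the
  quotient of the mean by D is at most |T| because \<open>sigma_hat\<close> is at most D and sqrt n
  is at most n.\<close>

lemma ratio_le_abs_t_statistic:
  assumes "n \<ge> 2"
  shows "\<bar>x 1\<bar> / max_dev n (x 1) x \<le> \<bar>t_statistic n x\<bar> + 1"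
proof (cases "0 < max_dev n (x 1) x")
  case True
  let ?D = "max_dev n (x 1) x"
  have pos: "0 < sigma_hat n x" using True sigma_hat_pos_iff[OF assms] by blast
  have "\<bar>n * x 1\<bar> \<le> \<bar>partial_sum n x\<bar> + n * ?D"
    using abs_partial_sum_diff_le[OF assms, of x] by linarith
  then have "\<bar>x 1\<bar> / ?D \<le> \<bar>partial_sum n x\<bar> / (n * ?D) + 1"
    using assms True by (simp add: field_simps abs_mult)
  also have "\<bar>partial_sum n x\<bar> / (n * ?D) \<le> \<bar>partial_sum n x\<bar> / (sqrt n * sigma_hat n x)"
    using assms pos sigma_hat_le_max_dev[OF assms, of x]
    by (intro divide_left_mono mult_mono) (auto simp: sqrt_le_D real_le_lsqrt power2_eq_square)
  finally show ?thesis
    by (simp add: abs_t_statistic_eq[OF pos])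
next
  case False
  then show ?thesis
    using max_dev_nonneg[OF assms, of "x 1" x] by simp
qed

section \<open>Pointwise form of the integrands in (ii) and (iii)\<close>

text \<open>A negative power is decreasing, so the minimum is attained at the largest deviation. If
  all deviations are 0, the indicator fails on the left and \<open>0 powr r\<close> makes the right
  side 0.\<close>

lemma Min_abs_neg_power:
  assumes "n \<ge> 2" "r > 0"
  shows "(if \<exists>i\<in>{1..n}. \<bar>x i - x 1\<bar> > 0
      then ennreal (\<bar>x 1\<bar> powr r) * Min ((\<lambda>i. abs_neg_power r (x i - x 1)) ` {2..n})
      else 0) = ennreal ((\<bar>x 1\<bar> / max_dev n (x 1) x) powr r)"
proof (cases "0 < max_dev n (x 1) x")
  case True
  let ?D = "max_dev n (x 1) x"
  obtain k where k: "k \<in> {2..n}" "?D = \<bar>x k - x 1\<bar>"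
    using max_dev_attained[OF assms(1)] .
  have "Min ((\<lambda>i. abs_neg_power r (x i - x 1)) ` {2..n}) = abs_neg_power r (x k - x 1)"
  proof (rule Min_eqI)
    fix y assume "y \<in> (\<lambda>i. abs_neg_power r (x i - x 1)) ` {2..n}"
    then obtain i where i: "i \<in> {2..n}" "y = abs_neg_power r (x i - x 1)" by blast
    then show "abs_neg_power r (x k - x 1) \<le> y"
      using max_dev_upper[of i n x "x 1"] k True assms(2)
      by (auto simp: abs_neg_power_def intro!: ennreal_leI powr_mono2')
  qed (use k in auto)
  also have "\<dots> = ennreal (?D powr - r)"
    using True k by (auto simp: abs_neg_power_def)
  finally have "Min ((\<lambda>i. abs_neg_power r (x i - x 1)) ` {2..n}) = ennreal (?D powr - r)" .
  moreover have "\<exists>i\<in>{1..n}. \<bar>x i - x 1\<bar> > 0"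
    using k True by (intro bexI[of _ k]) auto
  ultimately show ?thesis
    using True by (simp add: ennreal_mult[symmetric] powr_divide powr_minus_divide)
next
  case False
  then have D: "max_dev n (x 1) x = 0"
    using max_dev_nonneg[OF assms(1), of "x 1" x] by simp
  have eq: "\<not> (\<exists>i\<in>{1..n}. \<bar>x i - x 1\<bar> > 0)"
    using max_dev_first[OF _ assms(1), of _ x] unfolding D not_less[symmetric] by blast
  show ?thesis unfolding D if_not_P[OF eq] by simp
qed

text \<open>For 0 < d < |c| the indicator leaves the range d / |c| < h < 1, and the weight has
  antiderivative - h powr (- r) / r. Otherwise no h in the unit interval qualifies, and the right
  side is \<open>ennreal\<close> of a nonpositive number, hence 0.\<close>

lemma nn_integral_power_weight:
  fixes r c d :: real
  assumes "r > 0" "0 \<le> d"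
  shows "(\<integral>\<^sup>+h\<in>{0<..<1}. ennreal (h powr (- (r + 1))) * indicator {h. 0 < d \<and> d < h * \<bar>c\<bar>} h \<partial>lborel)
    = ennreal (((\<bar>c\<bar> / d) powr r - 1) / r)"
proof (cases "0 < d \<and> d < \<bar>c\<bar>")
  case True
  define a where "a = d / \<bar>c\<bar>"
  have a: "0 < a" "a < 1" using True by (auto simp: a_def)
  have "(\<integral>\<^sup>+h\<in>{0<..<1}. ennreal (h powr (- (r + 1))) * indicator {h. 0 < d \<and> d < h * \<bar>c\<bar>} h \<partial>lborel)
      = (\<integral>\<^sup>+h. ennreal (h powr (- (r + 1))) * indicator {a..1} h \<partial>lborel)"
  proof (rule nn_integral_cong_AE)
    \<comment> \<open>The range of \<open>h\<close> differs from \<open>{a..1}\<close> only in the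
      endpoints, which are null; the closed interval suits the fundamental theorem of
      calculus.\<close>
    have "AE h in lborel. h \<noteq> a \<and> h \<noteq> (1::real)"
      using AE_lborel_singleton[of a] AE_lborel_singleton[of "1::real"] by eventually_elim auto
    then show "AE h in lborel.
        ennreal (h powr (- (r + 1))) * indicator {h. 0 < d \<and> d < h * \<bar>c\<bar>} h * indicator {0<..<1} h
        = ennreal (h powr (- (r + 1))) * indicator {a..1} h"
    proof eventually_elim
      case (elim h)
      have "d < h * \<bar>c\<bar> \<longleftrightarrow> a < h"
        using True by (auto simp: a_def pos_divide_less_eq)
      then show ?case
        using elim a True by (auto simp: indicator_def)
    qed
  qed
  also have "\<dots> = ennreal (- (1 powr (- r) / r) - - (a powr (- r) / r))"
  proof (rule nn_integral_FTC_Icc)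
    fix h assume "h \<in> {a..1}"
    \<comment> \<open>Positivity of \<open>a\<close> keeps the interval away from the singularity of
      the weight at 0.\<close>
    then have "0 < h" using a by auto
    then show "((\<lambda>h. - (h powr (- r) / r)) has_real_derivative h powr (- (r + 1))) (at h)"
      using assms(1) by (auto intro!: derivative_eq_intros simp: minus_diff_commute)
  qed (use a in auto)
  also have "- (1 powr (- r) / r) - - (a powr (- r) / r) = ((\<bar>c\<bar> / d) powr r - 1) / r"
    using True by (simp add: a_def powr_minus powr_divide diff_divide_distrib)
  finally show ?thesis .
next
  case False
  have "h * \<bar>c\<bar> \<le> \<bar>c\<bar>" if "h < 1" for h
    using that mult_right_mono[of h 1 "\<bar>c\<bar>"] by simp
  then have "\<not> (0 < d \<and> d < h * \<bar>c\<bar>)" if "h < 1" for h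
    using False that by (meson less_le_trans)
  then have "(\<integral>\<^sup>+h\<in>{0<..<1}. ennreal (h powr (- (r + 1))) * indicator {h. 0 < d \<and> d < h * \<bar>c\<bar>} h \<partial>lborel)
      = (\<integral>\<^sup>+h. 0 \<partial>(lborel :: real measure))"
    by (intro nn_integral_cong) (auto simp: indicator_def)
  \<comment> \<open>Either \<open>d\<close> is 0 and so is the quotient, or \<open>d\<close> is at
    least |c|.\<close>
  moreover have "(\<bar>c\<bar> / d) powr r \<le> 1"
    using False assms powr_mono2[of r "\<bar>c\<bar> / d" 1] by (cases "d = 0") auto
  then have "ennreal (((\<bar>c\<bar> / d) powr r - 1) / r) = 0"
    using assms(1) by (intro ennreal_neg) (simp add: divide_nonpos_pos)
  ultimately show ?thesis by simp
qed

section \<open>Finiteness of expectations under linear bounds\<close>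

lemma (in prob_space) nn_integral_powr_finite:
  fixes f g :: "'a \<Rightarrow> real"
  assumes [measurable]: "g \<in> borel_measurable M"
    and fg: "\<And>\<omega>. 0 \<le> f \<omega>" "\<And>\<omega>. f \<omega> \<le> C * (g \<omega> + 1)" "\<And>\<omega>. 0 \<le> g \<omega>"
    and "0 \<le> C" "0 < r"
    and fin: "(\<integral>\<^sup>+\<omega>. ennreal (g \<omega> powr r) \<partial>M) < \<infinity>"
  shows "(\<integral>\<^sup>+\<omega>. ennreal (f \<omega> powr r) \<partial>M) < \<infinity>"
proof -
  have bound: "f \<omega> powr r \<le> (2 * C) powr r * (g \<omega> powr r + 1)" for \<omega>
  proof -
    \<comment> \<open>Replacing \<open>g + 1\<close> by twice the maximum of \<open>g\<close> and 1
      makes the bound a product, on which \<open>powr\<close> is multiplicative; this works for r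
      below 1 as well as above.\<close>
    have "f \<omega> \<le> C * (2 * max (g \<omega>) 1)"
      using fg(2)[of \<omega>] \<open>0 \<le> C\<close> by (smt (verit) mult_left_mono)
    then have "f \<omega> powr r \<le> (2 * C * max (g \<omega>) 1) powr r"
      using fg(1) \<open>0 < r\<close> by (intro powr_mono2) (auto simp: ac_simps)
    also have "\<dots> = (2 * C) powr r * max (g \<omega>) 1 powr r"
      by (rule powr_mult)
    also have "\<dots> \<le> (2 * C) powr r * (g \<omega> powr r + 1)"
      by (intro mult_left_mono) (auto simp: max_def)
    finally show ?thesis .
  qed
  have "(\<integral>\<^sup>+\<omega>. ennreal (f \<omega> powr r) \<partial>M)
      \<le> (\<integral>\<^sup>+\<omega>. ennreal ((2 * C) powr r) * (ennreal (g \<omega> powr r) + 1) \<partial>M)"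
    using bound by (intro nn_integral_mono)
      (simp add: ennreal_mult[symmetric] ennreal_leI flip: ennreal_1 ennreal_plus)
  also have "\<dots> = ennreal ((2 * C) powr r) * ((\<integral>\<^sup>+\<omega>. ennreal (g \<omega> powr r) \<partial>M) + 1)"
    by (simp add: nn_integral_cmult nn_integral_add emeasure_space_1)
  also have "\<dots> < \<infinity>"
    using fin by (simp add: ennreal_mult_less_top)
  finally show ?thesis .
qed

text \<open>\<open>ennreal\<close> cuts negative values to 0, so the left integrand is a positive
  part. Multiplied by r it differs from \<open>f\<close> by at most 1, which has finite integral
  over a probability space.\<close>

lemma (in prob_space) nn_integral_positive_part_finite_iff:
  fixes f :: "'a \<Rightarrow> real"
  assumes [measurable]: "f \<in> borel_measurable M" and f: "\<And>\<omega>. 0 \<le> f \<omega>" and "0 < r"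
  shows "(\<integral>\<^sup>+\<omega>. ennreal ((f \<omega> - 1) / r) \<partial>M) < \<infinity> \<longleftrightarrow> (\<integral>\<^sup>+\<omega>. ennreal (f \<omega>) \<partial>M) < \<infinity>"
proof
  assume fin: "(\<integral>\<^sup>+\<omega>. ennreal ((f \<omega> - 1) / r) \<partial>M) < \<infinity>"
  have "ennreal (f \<omega>) \<le> ennreal r * ennreal ((f \<omega> - 1) / r) + 1" for \<omega>
  proof (cases "f \<omega> \<le> 1")
    case True
    then have "ennreal (f \<omega>) \<le> 1" by simp
    then show ?thesis by (rule order.trans) simp
  next
    case False
    then show ?thesis
      using \<open>0 < r\<close> by (simp add: ennreal_mult[symmetric] flip: ennreal_1 ennreal_plus)
  qed
  then have "(\<integral>\<^sup>+\<omega>. ennreal (f \<omega>) \<partial>M) \<le> (\<integral>\<^sup>+\<omega>. ennreal r * ennreal ((f \<omega> - 1) / r) + 1 \<partial>M)"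
    by (intro nn_integral_mono)
  also have "\<dots> = ennreal r * (\<integral>\<^sup>+\<omega>. ennreal ((f \<omega> - 1) / r) \<partial>M) + 1"
    by (simp add: nn_integral_cmult nn_integral_add emeasure_space_1)
  also have "\<dots> < \<infinity>"
    using fin by (simp add: ennreal_mult_less_top)
  finally show "(\<integral>\<^sup>+\<omega>. ennreal (f \<omega>) \<partial>M) < \<infinity>" .
next
  assume fin: "(\<integral>\<^sup>+\<omega>. ennreal (f \<omega>) \<partial>M) < \<infinity>"
  have "(\<integral>\<^sup>+\<omega>. ennreal ((f \<omega> - 1) / r) \<partial>M) \<le> (\<integral>\<^sup>+\<omega>. ennreal (1 / r) * ennreal (f \<omega>) \<partial>M)"
    using \<open>0 < r\<close> f by (intro nn_integral_mono)
      (auto simp: ennreal_mult[symmetric] divide_right_mono intro!: ennreal_leI)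
  also have "\<dots> = ennreal (1 / r) * (\<integral>\<^sup>+\<omega>. ennreal (f \<omega>) \<partial>M)"
    by (simp add: nn_integral_cmult)
  also have "\<dots> < \<infinity>"
    using fin by (simp add: ennreal_mult_less_top)
  finally show "(\<integral>\<^sup>+\<omega>. ennreal ((f \<omega> - 1) / r) \<partial>M) < \<infinity>" .
qed

section \<open>The i.i.d. sample and the double integral (iii)\<close>

lemma measurable_max_dev [measurable (raw)]:
  assumes "f \<in> borel_measurable M" "\<And>i. i \<in> {2..n} \<Longrightarrow> (\<lambda>\<omega>. g \<omega> i) \<in> borel_measurable M"
  shows "(\<lambda>\<omega>. max_dev n (f \<omega>) (g \<omega>)) \<in> borel_measurable M"
  unfolding max_dev_def using assms by (intro borel_measurable_Max) auto

locale iid_real = prob_space M for M :: "'a measure" +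
  fixes X :: "nat \<Rightarrow> 'a \<Rightarrow> real" and F :: "real measure"
  assumes indep: "indep_vars (\<lambda>_. borel) X UNIV"
    and distr_X: "\<And>i. distr M borel (X i) = F"
begin

lemma X_measurable [measurable]: "X i \<in> borel_measurable M"
  using indep by (auto simp: indep_vars_def)

text \<open>Any index \<open>i\<close> serves, so probabilities about \<open>X 0\<close> and about
  the sample all become values of \<open>F\<close>.\<close>

lemma prob_X:
  assumes "A \<in> sets borel"
  shows "prob {\<omega> \<in> space M. X i \<omega> \<in> A} = measure F A"
  using assms by (subst distr_X[symmetric, of i])
    (auto simp: measure_distr vimage_def Int_def intro!: arg_cong[where f=prob])

text \<open>By independence the probability factors over \<open>{2..n}\<close>, which has
  \<open>n - 1\<close> elements; this is the source of the exponent in (iii).\<close>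

lemma prob_all_in:
  assumes "A \<in> sets borel" "n \<ge> 2"
  shows "prob {\<omega> \<in> space M. \<forall>i\<in>{2..n}. X i \<omega> \<in> A} = measure F A ^ (n - 1)"
proof -
  have "{\<omega> \<in> space M. \<forall>i\<in>{2..n}. X i \<omega> \<in> A} = (\<Inter>i\<in>{2..n}. X i -` A \<inter> space M)"
    using assms(2) by fastforce
  also have "prob \<dots> = (\<Prod>i\<in>{2..n}. prob (X i -` A \<inter> space M))"
    using assms by (intro indep_varsD[OF indep]) auto
  also have "\<dots> = (\<Prod>i\<in>{2..n}. measure F A)"
    using prob_X[OF assms(1)] by (intro prod.cong) (auto simp: vimage_def Int_def conj_commute)
  finally show ?thesis by simp
qed

text \<open>The deviation is below \<open>a\<close> iff the other observations all lie within
  \<open>a\<close> of \<open>x\<close>, and is 0 iff they all equal \<open>x\<close>. The second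
  event lies in the first since \<open>a\<close> is positive, so the probabilities subtract.\<close>

lemma emeasure_max_dev_between:
  assumes "n \<ge> 2" "0 < a"
  shows "emeasure M {\<omega> \<in> space M. 0 < max_dev n x (\<lambda>i. X i \<omega>) \<and> max_dev n x (\<lambda>i. X i \<omega>) < a}
    = ennreal (measure F {y. \<bar>y - x\<bar> < a} ^ (n - 1) - measure F {x} ^ (n - 1))"
    (is "emeasure M ?E = _")
proof -
  let ?A = "{\<omega> \<in> space M. \<forall>i\<in>{2..n}. X i \<omega> \<in> {y. \<bar>y - x\<bar> < a}}"
  let ?B = "{\<omega> \<in> space M. \<forall>i\<in>{2..n}. X i \<omega> \<in> {x}}"
  have "?E = ?A - ?B"
    using assms by (auto simp: max_dev_less_iff max_dev_pos_iff)
  moreover have "prob (?A - ?B) = prob ?A - prob ?B"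
    using assms by (intro finite_measure_Diff) auto
  ultimately show ?thesis
    using assms by (simp only: emeasure_eq_measure prob_all_in borel_open open_Collect_less
      continuous_intros sets.empty_sets) (subst prob_all_in, auto)
qed

text \<open>The first observation is independent of the block of the others, so their joint law is a
  product and Tonelli allows the block to be integrated out first.\<close>

lemma nn_integral_first_rest:
  assumes [measurable]: "case_prod G \<in> borel_measurable (borel \<Otimes>\<^sub>M PiM {2..n} (\<lambda>_. borel))"
  shows "(\<integral>\<^sup>+x. (\<integral>\<^sup>+\<omega>. G x (\<lambda>i\<in>{2..n}. X i \<omega>) \<partial>M) \<partial>F)
    = (\<integral>\<^sup>+\<omega>. G (X 1 \<omega>) (\<lambda>i\<in>{2..n}. X i \<omega>) \<partial>M)"
proof -
  let ?N = "PiM {2..n} (\<lambda>_. borel :: real measure)" and ?N1 = "PiM {1::nat} (\<lambda>_. borel :: real measure)"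
  let ?Y = "\<lambda>\<omega>. \<lambda>i\<in>{2..n}. X i \<omega>" and ?Z = "\<lambda>\<omega>. \<lambda>i\<in>{1}. X i \<omega>"
  have Y [measurable]: "?Y \<in> measurable M ?N" by measurable
  have Z [measurable]: "?Z \<in> measurable M ?N1" by measurable
  interpret Y: prob_space "distr M ?N ?Y" by (rule prob_space_distr[OF Y])
  \<comment> \<open>Independence of blocks concerns restrictions to index sets, so the first
    observation enters as a function on \<open>{1}\<close> and is read off below as
    \<open>z 1\<close>.\<close>
  have "indep_var ?N1 ?Z ?N ?Y"
    by (rule indep_var_restrict[OF indep]) auto
  then have eq: "distr M ?N1 ?Z \<Otimes>\<^sub>M distr M ?N ?Y = distr M (?N1 \<Otimes>\<^sub>M ?N) (\<lambda>\<omega>. (?Z \<omega>, ?Y \<omega>))"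
    unfolding indep_var_distribution_eq by blast
  have [measurable]: "(\<lambda>x. \<integral>\<^sup>+y. G x y \<partial>distr M ?N ?Y) \<in> borel_measurable borel"
    by measurable
  have [measurable]: "(\<lambda>(z, y). G (z 1) y) \<in> borel_measurable (?N1 \<Otimes>\<^sub>M ?N)"
    by measurable
  have "(\<integral>\<^sup>+x. (\<integral>\<^sup>+\<omega>. G x (?Y \<omega>) \<partial>M) \<partial>F) = (\<integral>\<^sup>+x. (\<integral>\<^sup>+y. G x y \<partial>distr M ?N ?Y) \<partial>F)"
    by (intro nn_integral_cong) (subst nn_integral_distr, measurable)
  also have "\<dots> = (\<integral>\<^sup>+\<omega>. (\<integral>\<^sup>+y. G (X 1 \<omega>) y \<partial>distr M ?N ?Y) \<partial>M)"
    unfolding distr_X[of 1, symmetric] by (subst nn_integral_distr) auto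
  also have "\<dots> = (\<integral>\<^sup>+z. (\<integral>\<^sup>+y. G (z 1) y \<partial>distr M ?N ?Y) \<partial>distr M ?N1 ?Z)"
    by (subst nn_integral_distr[OF Z]) auto
  also have "\<dots> = (\<integral>\<^sup>+p. (case p of (z, y) \<Rightarrow> G (z 1) y) \<partial>(distr M ?N1 ?Z \<Otimes>\<^sub>M distr M ?N ?Y))"
    by (subst Y.nn_integral_fst[symmetric]) auto
  also have "\<dots> = (\<integral>\<^sup>+\<omega>. G (X 1 \<omega>) (?Y \<omega>) \<partial>M)"
    unfolding eq by (subst nn_integral_distr) auto
  finally show ?thesis .
qed

text \<open>For fixed \<open>x\<close> the bracket is the probability of an event; exchanging the
  integrals leaves an explicit integral in \<open>h\<close>. Independence then puts
  \<open>X 1\<close> in place of \<open>x\<close>.\<close>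

lemma nn_integral_concentration:
  assumes n: "n \<ge> 2" and r: "r > 0"
  shows "(\<integral>\<^sup>+ x\<in>{x. x \<noteq> 0}. (\<integral>\<^sup>+ h\<in>{0<..<1}. ennreal (h powr (- (r + 1))
        * (measure F {y. \<bar>y - x\<bar> < h * \<bar>x\<bar>} ^ (n - 1) - measure F {x} ^ (n - 1))) \<partial>lborel) \<partial>F)
    = (\<integral>\<^sup>+\<omega>. ennreal (((\<bar>X 1 \<omega>\<bar> / max_dev n (X 1 \<omega>) (\<lambda>i. X i \<omega>)) powr r - 1) / r) \<partial>M)"
proof -
  let ?w = "\<lambda>h. ennreal (h powr (- (r + 1)))"
  let ?D = "\<lambda>x \<omega>. max_dev n x (\<lambda>i. X i \<omega>)"
  interpret pair_sigma_finite M "lborel :: real measure" ..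
  have inner: "(\<integral>\<^sup>+ h\<in>{0<..<1}. ennreal (h powr (- (r + 1))
        * (measure F {y. \<bar>y - x\<bar> < h * \<bar>x\<bar>} ^ (n - 1) - measure F {x} ^ (n - 1))) \<partial>lborel)
      = (\<integral>\<^sup>+\<omega>. ennreal (((\<bar>x\<bar> / ?D x \<omega>) powr r - 1) / r) \<partial>M)" if "x \<noteq> 0" for x
  proof -
    let ?E = "\<lambda>h. {\<omega> \<in> space M. 0 < ?D x \<omega> \<and> ?D x \<omega> < h * \<bar>x\<bar>}"
    have "(\<integral>\<^sup>+ h\<in>{0<..<1}. ennreal (h powr (- (r + 1))
        * (measure F {y. \<bar>y - x\<bar> < h * \<bar>x\<bar>} ^ (n - 1) - measure F {x} ^ (n - 1))) \<partial>lborel)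
      = (\<integral>\<^sup>+h. (\<integral>\<^sup>+\<omega>. ?w h * indicator {h. 0 < ?D x \<omega> \<and> ?D x \<omega> < h * \<bar>x\<bar>} h
          * indicator {0<..<1} h \<partial>M) \<partial>lborel)"
    proof (rule nn_integral_cong)
      \<comment> \<open>For fixed \<open>h\<close> the indicator is read as that of an event in
        \<omega>.\<close>
      fix h :: real
      have "(\<integral>\<^sup>+\<omega>. ?w h * indicator {h. 0 < ?D x \<omega> \<and> ?D x \<omega> < h * \<bar>x\<bar>} h * indicator {0<..<1} h \<partial>M)
        = (\<integral>\<^sup>+\<omega>. ?w h * indicator {0<..<1} h * indicator (?E h) \<omega> \<partial>M)"
        by (intro nn_integral_cong) (auto simp: indicator_def)
      also have "\<dots> = ?w h * indicator {0<..<1} h * emeasure M (?E h)"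
        by (subst nn_integral_cmult_indicator) auto
      \<comment> \<open>For \<open>h\<close> in the unit interval the radius
        \<open>h * \<bar>x\<bar>\<close> is positive because \<open>x\<close> is nonzero; for other
        \<open>h\<close> both sides are 0.\<close>
      also have "\<dots> = ennreal (h powr (- (r + 1))
        * (measure F {y. \<bar>y - x\<bar> < h * \<bar>x\<bar>} ^ (n - 1) - measure F {x} ^ (n - 1)))
        * indicator {0<..<1} h"
        using emeasure_max_dev_between[OF n, of "h * \<bar>x\<bar>" x] that
        by (auto simp: indicator_def ennreal_mult')
      finally show "ennreal (h powr (- (r + 1))
        * (measure F {y. \<bar>y - x\<bar> < h * \<bar>x\<bar>} ^ (n - 1) - measure F {x} ^ (n - 1)))
        * indicator {0<..<1} h = (\<integral>\<^sup>+\<omega>. ?w h * indicator {h. 0 < ?D x \<omega> \<and> ?D x \<omega> < h * \<bar>x\<bar>} h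
          * indicator {0<..<1} h \<partial>M)" ..
    qed
    also have "\<dots> = (\<integral>\<^sup>+\<omega>. (\<integral>\<^sup>+h. ?w h * indicator {h. 0 < ?D x \<omega> \<and> ?D x \<omega> < h * \<bar>x\<bar>} h
          * indicator {0<..<1} h \<partial>lborel) \<partial>M)"
      by (rule Fubini') measurable
    also have "\<dots> = (\<integral>\<^sup>+\<omega>. ennreal (((\<bar>x\<bar> / ?D x \<omega>) powr r - 1) / r) \<partial>M)"
      using nn_integral_power_weight[OF r max_dev_nonneg[OF n]] by simp
    finally show ?thesis .
  qed
  have "(\<integral>\<^sup>+ x\<in>{x. x \<noteq> 0}. (\<integral>\<^sup>+ h\<in>{0<..<1}. ennreal (h powr (- (r + 1))
        * (measure F {y. \<bar>y - x\<bar> < h * \<bar>x\<bar>} ^ (n - 1) - measure F {x} ^ (n - 1))) \<partial>lborel) \<partial>F)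
      = (\<integral>\<^sup>+ x. (\<integral>\<^sup>+\<omega>. ennreal (((\<bar>x\<bar> / max_dev n x (\<lambda>i\<in>{2..n}. X i \<omega>)) powr r - 1) / r) \<partial>M) \<partial>F)"
  proof (rule nn_integral_cong)
    fix x
    show "(\<integral>\<^sup>+ h\<in>{0<..<1}. ennreal (h powr (- (r + 1))
        * (measure F {y. \<bar>y - x\<bar> < h * \<bar>x\<bar>} ^ (n - 1) - measure F {x} ^ (n - 1))) \<partial>lborel)
        * indicator {x. x \<noteq> 0} x
      = (\<integral>\<^sup>+\<omega>. ennreal (((\<bar>x\<bar> / max_dev n x (\<lambda>i\<in>{2..n}. X i \<omega>)) powr r - 1) / r) \<partial>M)"
    proof (cases "x = 0")
      \<comment> \<open>At 0 the ratio vanishes and the integrand is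
        \<open>ennreal (- 1 / r)\<close>, that is 0, in agreement with the exclusion of 0 on the
        left.\<close>
      case True
      then show ?thesis using r by (simp add: ennreal_neg)
    next
      case False
      then show ?thesis using inner[OF False] by (simp add: max_dev_restrict)
    qed
  qed
  also have "\<dots> = (\<integral>\<^sup>+\<omega>. ennreal (((\<bar>X 1 \<omega>\<bar> / max_dev n (X 1 \<omega>) (\<lambda>i\<in>{2..n}. X i \<omega>)) powr r - 1) / r) \<partial>M)"
    by (rule nn_integral_first_rest) measurable
  finally show ?thesis by (simp add: max_dev_restrict)
qed

end

theorem theorem3p1:
  fixes M :: "'a measure" and X :: "nat \<Rightarrow> 'a \<Rightarrow> real" and F :: "real measure"
    and n :: nat and r :: real and p :: "real \<Rightarrow> real"
    and Q1 Q2 Q3 :: ennreal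
  assumes "prob_space M"
    and "prob_space.indep_vars M (\<lambda>_. borel) X UNIV"
    and "\<And>i. distr M borel (X i) = F"
    and "n \<ge> 2" and "r > 0"
    and p_def: "\<And>x. p x = measure M {\<omega> \<in> space M. X 0 \<omega> = x}"
    and Q1_def: "Q1 = (\<integral>\<^sup>+ \<omega>. ennreal (\<bar>t_statistic n (\<lambda>i. X i \<omega>)\<bar> powr r) \<partial>M)"
    and Q2_def: "Q2 = (\<integral>\<^sup>+ \<omega>.
           (if \<exists>i\<in>{1..n}. \<bar>X i \<omega> - X 1 \<omega>\<bar> > 0
            then ennreal (\<bar>X 1 \<omega>\<bar> powr r)
                   * Min ((\<lambda>i. abs_neg_power r (X i \<omega> - X 1 \<omega>)) ` {2..n})
            else 0) \<partial>M)"
    and Q3_def: "Q3 = (\<integral>\<^sup>+ x\<in>{x. x \<noteq> 0}.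
           (\<integral>\<^sup>+ h\<in>{0<..<1}.
              ennreal (h powr (- (r + 1))
                * (measure M {\<omega> \<in> space M. \<bar>X 0 \<omega> - x\<bar> < h * \<bar>x\<bar>} ^ (n - 1)
                   - p x ^ (n - 1))) \<partial>lborel) \<partial>F)"
  shows "(Q1 < \<infinity> \<and> Q2 < \<infinity> \<and> Q3 < \<infinity>) \<or> (Q1 = \<infinity> \<and> Q2 = \<infinity> \<and> Q3 = \<infinity>)"
proof -
  interpret prob_space M by fact
  interpret iid_real M X F using assms(2,3) by unfold_locales
  define R where "R \<omega> = \<bar>X 1 \<omega>\<bar> / max_dev n (X 1 \<omega>) (\<lambda>i. X i \<omega>)" for \<omega>
  have R_nonneg: "0 \<le> R \<omega>" for \<omega>
    using max_dev_nonneg[OF \<open>n \<ge> 2\<close>] by (simp add: R_def)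
  have [measurable]: "R \<in> borel_measurable M"
    unfolding R_def by measurable
  have [measurable]: "(\<lambda>\<omega>. t_statistic n (\<lambda>i. X i \<omega>)) \<in> borel_measurable M"
    unfolding t_statistic_def sigma_hat_def partial_sum_def by measurable
  have Q2: "Q2 = (\<integral>\<^sup>+\<omega>. ennreal (R \<omega> powr r) \<partial>M)"
    unfolding Q2_def R_def using \<open>n \<ge> 2\<close> \<open>r > 0\<close>
    by (intro nn_integral_cong Min_abs_neg_power[where x="\<lambda>i. X i _"])
  \<comment> \<open>\<open>X 0\<close> lies outside the sample and only represents the common law,
    so both probabilities become values of \<open>F\<close>.\<close>
  have "Q3 = (\<integral>\<^sup>+\<omega>. ennreal ((R \<omega> powr r - 1) / r) \<partial>M)"
    unfolding Q3_def R_def nn_integral_concentration[OF \<open>n \<ge> 2\<close> \<open>r > 0\<close>, symmetric] p_def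
    using prob_X[of "{y. \<bar>y - _\<bar> < _}" 0] prob_X[of "{_}" 0] by simp
  then have "Q3 < \<infinity> \<longleftrightarrow> Q2 < \<infinity>"
    unfolding Q2 using nn_integral_positive_part_finite_iff[of "\<lambda>\<omega>. R \<omega> powr r" r] \<open>r > 0\<close> by simp
  \<comment> \<open>Each linear bound gives one implication: here |T| is dominated by
    \<open>R\<close> with the constant of the upper bound, below \<open>R\<close> is dominated by
    |T| with constant 1.\<close>
  moreover have "Q1 < \<infinity>" if "Q2 < \<infinity>"
    unfolding Q1_def
    using nn_integral_powr_finite[of R "\<lambda>\<omega>. \<bar>t_statistic n (\<lambda>i. X i \<omega>)\<bar>"
        "sqrt (2 * real n * (real n - 1))" r]
      abs_t_statistic_le[OF \<open>n \<ge> 2\<close>, of "\<lambda>i. X i _"] R_nonneg that \<open>r > 0\<close> \<open>n \<ge> 2\<close>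
    by (simp add: Q2 R_def)
  moreover have "Q2 < \<infinity>" if "Q1 < \<infinity>"
    unfolding Q2
    using nn_integral_powr_finite[of "\<lambda>\<omega>. \<bar>t_statistic n (\<lambda>i. X i \<omega>)\<bar>" R 1 r]
      ratio_le_abs_t_statistic[OF \<open>n \<ge> 2\<close>, of "\<lambda>i. X i _"] R_nonneg that \<open>r > 0\<close>
    by (simp add: Q1_def R_def)
  ultimately show ?thesis
    by (auto simp: less_top[symmetric])
qed

end
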